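(* Let $X$ be a nonempty set, let $\equiv$ be an equivalence relation on $X$, and let $Q=\{X_j : j\in J\}$ be the partition of $X$ corresponding to $\equiv$, i.e. the set of all equivalence classes of $\equiv$ (different indices giving different blocks). Then the following statements hold: (i) The inequality $|J|\leqslant\mathfrak{c}$ holds if and only if there is a strongly rigid pseudometric space $(X,d)$ such that $$(x\equiv y)\Leftrightarrow(d(x,y)=0)$$ is valid for all $x,y\in X$. (ii) The equality $|J|=4$ holds if and only if there is a pseudorectangle $(X,d)$ such that $$(x\equiv y)\Leftrightarrow(d(x,y)=0)$$ is valid for all $x,y\in X$.
   Context: Here $\mathfrak{c}$ denotes the cardinality of the continuum. A pseudometric on a set $X$ is a function $d\colon X^2\to\mathbb{R}$ that is non-negative, symmetric, satisfies $d(x,x)=0$ for all $x\in X$, and satisfies the triangle inequality; $(X,d)$ is then called a pseudometric space. A metric subspace of $(X,d)$ is a subset $Y\subseteq X$ such that the restriction of $d$ to $Y^2$ is a metric. A metric space $(Y,d)$ is strongly rigid if, for all $x,y,u,v\in Y$, the condition $d(x,y)=d(u,v)\neq 0$ implies ($x=u$ and $y=v$) or ($x=v$ and $y=u$). A pseudometric space $(X,d)$ is strongly rigid if every metric subspace of $(X,d)$ is strongly rigid. A pseudometric space $(X,d)$ is a pseudorectangle if all three-point metric subspaces of $(X,d)$ are strongly rigid and isometric (to each other) and, in addition, there is a four-point metric subspace $Y$ of $(X,d)$ such that for every $x\in X$ there is $y\in Y$ with $d(x,y)=0$. *)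

theory Defs
  imports "HOL-Analysis.Analysis" "HOL-Library.Equipollence"
begin

definition pseudometric_on :: "'a set \<Rightarrow> ('a \<Rightarrow> 'a \<Rightarrow> real) \<Rightarrow> bool" where
  "pseudometric_on X d \<longleftrightarrow>
     (\<forall>x\<in>X. \<forall>y\<in>X. 0 \<le> d x y) \<and>
     (\<forall>x\<in>X. \<forall>y\<in>X. d x y = d y x) \<and>
     (\<forall>x\<in>X. d x x = 0) \<and>
     (\<forall>x\<in>X. \<forall>y\<in>X. \<forall>z\<in>X. d x z \<le> d x y + d y z)"

text \<open>
  The locale \<open>Metric_space\<close> demands non-negativity and symmetry on the whole type, so the
  restriction of \<open>d\<close> to \<open>Y \<times> Y\<close> is represented by its extension by zero.
\<close>

definition metric_subspace :: "'a set \<Rightarrow> 'a set \<Rightarrow> ('a \<Rightarrow> 'a \<Rightarrow> real) \<Rightarrow> bool" where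
  "metric_subspace Y X d \<longleftrightarrow>
     Y \<subseteq> X \<and> Metric_space Y (\<lambda>x y. if x \<in> Y \<and> y \<in> Y then d x y else 0)"

lemma metric_subspace_iff:
  "metric_subspace Y X d \<longleftrightarrow>
     Y \<subseteq> X \<and> pseudometric_on Y d \<and> (\<forall>x\<in>Y. \<forall>y\<in>Y. d x y = 0 \<longrightarrow> x = y)"
  unfolding metric_subspace_def pseudometric_on_def Metric_space_def
  by (intro conj_cong refl iffI; simp; metis)

definition strongly_rigid_metric :: "'a set \<Rightarrow> ('a \<Rightarrow> 'a \<Rightarrow> real) \<Rightarrow> bool" where
  "strongly_rigid_metric Y d \<longleftrightarrow>
     (\<forall>x\<in>Y. \<forall>y\<in>Y. \<forall>u\<in>Y. \<forall>v\<in>Y.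
        d x y = d u v \<and> d u v \<noteq> 0 \<longrightarrow> (x = u \<and> y = v) \<or> (x = v \<and> y = u))"

definition strongly_rigid_pseudometric :: "'a set \<Rightarrow> ('a \<Rightarrow> 'a \<Rightarrow> real) \<Rightarrow> bool" where
  "strongly_rigid_pseudometric X d \<longleftrightarrow>
     pseudometric_on X d \<and> (\<forall>Y. metric_subspace Y X d \<longrightarrow> strongly_rigid_metric Y d)"

definition isometric_spaces ::
    "'a set \<Rightarrow> ('a \<Rightarrow> 'a \<Rightarrow> real) \<Rightarrow> 'b set \<Rightarrow> ('b \<Rightarrow> 'b \<Rightarrow> real) \<Rightarrow> bool" where
  "isometric_spaces Y d Z e \<longleftrightarrow>
     (\<exists>f. bij_betw f Y Z \<and> (\<forall>x\<in>Y. \<forall>y\<in>Y. e (f x) (f y) = d x y))"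

definition pseudorectangle :: "'a set \<Rightarrow> ('a \<Rightarrow> 'a \<Rightarrow> real) \<Rightarrow> bool" where
  "pseudorectangle X d \<longleftrightarrow>
     pseudometric_on X d \<and>
     (\<forall>Y. metric_subspace Y X d \<and> card Y = 3 \<longrightarrow> strongly_rigid_metric Y d) \<and>
     (\<forall>Y Z. metric_subspace Y X d \<and> card Y = 3 \<and> metric_subspace Z X d \<and> card Z = 3
        \<longrightarrow> isometric_spaces Y d Z d) \<and>
     (\<exists>Y. metric_subspace Y X d \<and> card Y = 4 \<and> (\<forall>x\<in>X. \<exists>y\<in>Y. d x y = 0))"

end

theory Submission
  imports Defs
begin

text \<open>
  A strongly rigid metric embeds its points into the reals by the distance to a fixed point.
  Conversely, if all nonzero distances lie in an interval \<open>[a, 2 * a]\<close>, the triangle inequality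
  is automatic, so any injective labelling of the unordered pairs of blocks by numbers in
  such an interval gives a strongly rigid pseudometric; there are enough labels because
  the real line is equipollent to its square.

  For four blocks, the Klein four-group acts simply transitively on the blocks, and
  the distance is made to depend only on the group difference, with values 3, 4, 5. Removing one
  block leaves a triangle with these three sides, and translations carry each such triangle onto
  any other.
\<close>

lemma metric_subspace_of_pseudometric_on:
  assumes "pseudometric_on X d" "Y \<subseteq> X" "\<And>x y. x \<in> Y \<Longrightarrow> y \<in> Y \<Longrightarrow> d x y = 0 \<Longrightarrow> x = y"
  shows "metric_subspace Y X d"
  using assms unfolding metric_subspace_iff pseudometric_on_def by (meson subsetD)

lemma strongly_rigid_metric_lepoll_real:
  assumes "metric_subspace Y X d" "strongly_rigid_metric Y d"
  shows "Y \<lesssim> (UNIV :: real set)"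
proof (cases "Y = {}")
  case False
  then obtain a where a: "a \<in> Y" by blast
  have "inj_on (d a) Y"
  proof (rule inj_onI)
    fix x y assume xy: "x \<in> Y" "y \<in> Y" "d a x = d a y"
    show "x = y"
    \<comment> \<open>Strong rigidity says nothing about zero distances; there the metric axiom
      identifies \<open>x\<close> and \<open>y\<close> with \<open>a\<close>.\<close>
    proof (cases "d a y = 0")
      case True
      then have "a = x" "a = y"
        using assms(1) xy a unfolding metric_subspace_iff by auto
      then show ?thesis by simp
    next
      case False
      then show ?thesis
        using assms(2) xy a unfolding strongly_rigid_metric_def by metis
    qed
  qed
  then show ?thesis unfolding lepoll_def by blast
qed (simp add: empty_lepoll)

text \<open>Choice of one point per block: the class map is onto \<open>X // r\<close>, and
  \<open>subset_image_inj\<close> restricts it to a set on which it is injective with the same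
  image.\<close>

lemma quotient_representatives:
  obtains Y where "Y \<subseteq> X" "bij_betw (\<lambda>x. r `` {x}) Y (X // r)"
proof -
  have "X // r = (\<lambda>x. r `` {x}) ` X" by (auto simp: quotient_def)
  then have "X // r \<subseteq> (\<lambda>x. r `` {x}) ` X" by simp
  then obtain Y where "Y \<subseteq> X" "inj_on (\<lambda>x. r `` {x}) Y" "X // r = (\<lambda>x. r `` {x}) ` Y"
    unfolding subset_image_inj by blast
  then show thesis using that by (simp add: bij_betw_def)
qed

text \<open>Distance zero means equivalence, so the metric axiom puts at most one point of
  \<open>Y\<close> into each block, and the covering assumption puts at least one there.\<close>

lemma bij_betw_quotient_of_metric_subspace:
  assumes "equiv X r" "\<And>x y. x \<in> X \<Longrightarrow> y \<in> X \<Longrightarrow> (x, y) \<in> r \<longleftrightarrow> d x y = 0"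
    and "metric_subspace Y X d" "\<And>x. x \<in> X \<Longrightarrow> \<exists>y\<in>Y. d x y = 0"
  shows "bij_betw (\<lambda>x. r `` {x}) Y (X // r)"
proof -
  have "Y \<subseteq> X" and zero: "\<And>x y. x \<in> Y \<Longrightarrow> y \<in> Y \<Longrightarrow> d x y = 0 \<Longrightarrow> x = y"
    using assms(3) unfolding metric_subspace_iff by auto
  have "inj_on (\<lambda>x. r `` {x}) Y"
    by (rule inj_onI) (metis \<open>Y \<subseteq> X\<close> assms(1,2) eq_equiv_class subsetD zero)
  moreover have "(\<lambda>x. r `` {x}) ` Y = X // r"
  proof
    show "(\<lambda>x. r `` {x}) ` Y \<subseteq> X // r"
      using \<open>Y \<subseteq> X\<close> by (auto intro: quotientI)
    show "X // r \<subseteq> (\<lambda>x. r `` {x}) ` Y"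
    proof
      fix C assume "C \<in> X // r"
      then obtain x where x: "x \<in> X" "C = r `` {x}" by (auto elim: quotientE)
      then obtain y where "y \<in> Y" "d x y = 0" using assms(4) by blast
      then have "(x, y) \<in> r" using assms(2) x \<open>Y \<subseteq> X\<close> by blast
      then have "C = r `` {y}" using x equiv_class_eq[OF assms(1)] by simp
      then show "C \<in> (\<lambda>x. r `` {x}) ` Y" using \<open>y \<in> Y\<close> by blast
    qed
  qed
  ultimately show ?thesis by (simp add: bij_betw_def)
qed

text \<open>Lets both constructions of \<open>d\<close> start from a labelling of points whose
  fibres are exactly the blocks.\<close>

lemma equiv_quotient_label:
  assumes "equiv X r" "inj_on h (X // r)" "x \<in> X" "y \<in> X"
  shows "(x, y) \<in> r \<longleftrightarrow> h (r `` {x}) = h (r `` {y})"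
  using assms
  by (metis eq_equiv_class_iff inj_on_eq_iff quotientI)

lemma inj_real_pairs: "\<exists>p :: real \<times> real \<Rightarrow> real. inj p"
proof -
  include cardinal_syntax
  have "|(UNIV :: real set) \<times> (UNIV :: real set)| =o |UNIV :: real set|"
    by (rule card_of_Times_same_infinite) (rule infinite_UNIV_char_0)
  then obtain p :: "real \<times> real \<Rightarrow> real" where "bij_betw p (UNIV \<times> UNIV) UNIV"
    using card_of_ordIso by blast
  then show ?thesis by (auto simp: bij_betw_def)
qed

lemma strongly_rigid_pseudometric_of_real_label:
  fixes h :: "'a \<Rightarrow> real"
  obtains d where "strongly_rigid_pseudometric X d" "\<And>x y. d x y = 0 \<longleftrightarrow> h x = h y"
proof -
  obtain p :: "real \<times> real \<Rightarrow> real" where "inj p" using inj_real_pairs by blast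
  \<comment> \<open>Using \<open>min\<close> and \<open>max\<close> makes the code depend only on
    the unordered pair of labels. Since \<open>arctan\<close> is injective with values in (-2, 2),
    nonzero distances stay distinct and lie in [4, 8], where 8 = 2 * 4.\<close>
  define d where "d x y = (if h x = h y then 0
                  else 6 + arctan (p (min (h x) (h y), max (h x) (h y))))" for x y
  have bounds: "4 \<le> 6 + arctan t" "6 + arctan t \<le> 8" for t
    using arctan_lbound[of t] arctan_ubound[of t] pi_less_4 by linarith+
  have nz: "d x y = 0 \<longleftrightarrow> h x = h y" for x y
    unfolding d_def using bounds(1) by (smt (verit))
  have range: "h x \<noteq> h y \<Longrightarrow> 4 \<le> d x y" "d x y \<le> 8" "0 \<le> d x y" for x y
    unfolding d_def using bounds by (auto intro: order_trans[of _ 4])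
  have "pseudometric_on X d"
    unfolding pseudometric_on_def
  proof (intro conjI ballI)
    fix x y z
    show "d x z \<le> d x y + d y z"
    \<comment> \<open>If one summand vanishes, the other equals \<open>d x z\<close>; otherwise both
      are at least 4, and their sum is at least 8.\<close>
    proof (cases "h x = h y \<or> h y = h z")
      case True
      then show ?thesis unfolding d_def by auto
    next
      case False
      then show ?thesis using range(1)[of x y] range(1)[of y z] range(2)[of x z] by auto
    qed
  qed (use range nz in \<open>auto simp: d_def min.commute max.commute\<close>)
  moreover have "strongly_rigid_metric Y d" if "metric_subspace Y X d" for Y
    unfolding strongly_rigid_metric_def
  proof (intro ballI impI)
    fix x y u v
    assume Y: "x \<in> Y" "y \<in> Y" "u \<in> Y" "v \<in> Y" and eq: "d x y = d u v \<and> d u v \<noteq> 0"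
    \<comment> \<open>A metric subspace has at most one point per label, so it suffices to compare
      labels.\<close>
    have inj: "h a = h b \<Longrightarrow> a = b" if "a \<in> Y" "b \<in> Y" for a b
      using \<open>metric_subspace Y X d\<close> that nz unfolding metric_subspace_iff by blast
    have "h x \<noteq> h y" "h u \<noteq> h v" using eq nz by metis+
    then have "p (min (h x) (h y), max (h x) (h y)) = p (min (h u) (h v), max (h u) (h v))"
      using eq unfolding d_def by (auto simp: arctan_eq_iff)
    then have "min (h x) (h y) = min (h u) (h v)" "max (h x) (h y) = max (h u) (h v)"
      using \<open>inj p\<close> by (auto dest: injD)
    then have "h x = h u \<and> h y = h v \<or> h x = h v \<and> h y = h u"
      by (auto simp: min_def max_def split: if_splits)
    then show "x = u \<and> y = v \<or> x = v \<and> y = u" using inj Y by blast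
  qed
  ultimately have "strongly_rigid_pseudometric X d"
    unfolding strongly_rigid_pseudometric_def by blast
  then show thesis using nz that by blast
qed

text \<open>Euclidean distance between the vertices of a rectangle with sides 3 and 4 and hence
  diagonal 5; the Booleans are the coordinates of a vertex.\<close>

definition rectangle_dist :: "bool \<times> bool \<Rightarrow> bool \<times> bool \<Rightarrow> real" where
  "rectangle_dist p q =
     (if fst p = fst q then if snd p = snd q then 0 else 3 else if snd p = snd q then 4 else 5)"

lemma rectangle_dist_eq_0_iff: "rectangle_dist p q = 0 \<longleftrightarrow> p = q"
  by (auto simp: rectangle_dist_def prod_eq_iff)

definition klein_add :: "bool \<times> bool \<Rightarrow> bool \<times> bool \<Rightarrow> bool \<times> bool" where
  "klein_add p q = (fst p \<noteq> fst q, snd p \<noteq> snd q)"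

text \<open>Every group element is its own inverse, so each translation is an involution and thereby
  a bijection.\<close>

lemma klein_add_cancel [simp]: "klein_add p (klein_add p q) = q"
  by (auto simp: klein_add_def prod_eq_iff)

lemma klein_add_commute: "klein_add p q = klein_add q p"
  by (auto simp: klein_add_def)

lemma rectangle_dist_translate: "rectangle_dist (klein_add c p) (klein_add c q) = rectangle_dist p q"
  by (auto simp: rectangle_dist_def klein_add_def)

text \<open>Two different vertex pairs at the same nonzero distance are opposite sides or the two
  diagonals. Together they use all four vertices, which is impossible when both avoid
  \<open>m\<close>.\<close>

lemma strongly_rigid_rectangle_dist_triangle:
  assumes "p \<noteq> m" "q \<noteq> m" "s \<noteq> m" "t \<noteq> m"
    and "rectangle_dist p q = rectangle_dist s t" "rectangle_dist s t \<noteq> 0"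
  shows "(p = s \<and> q = t) \<or> (p = t \<and> q = s)"
proof -
  \<comment> \<open>The values 0, 3, 4, 5 are distinct, so a distance reveals which coordinates
    agree; the rest is propositional.\<close>
  have "fst p = fst q \<longleftrightarrow> fst s = fst t" "snd p = snd q \<longleftrightarrow> snd s = snd t"
    "\<not> (fst s = fst t \<and> snd s = snd t)"
    using assms(5,6) unfolding rectangle_dist_def by (simp_all split: if_split_asm)
  then show ?thesis
    using assms(1-4) unfolding prod_eq_iff by sat
qed

lemma bij_betw_complement_point:
  fixes h :: "'a \<Rightarrow> bool \<times> bool"
  assumes "inj_on h Y" "card Y = 3"
  obtains m where "bij_betw h Y (UNIV - {m})"
proof -
  have "card (UNIV - h ` Y) = 1"
    using assms card_image[OF assms(1)] by (simp add: card_Diff_subset)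
  then obtain m where "UNIV - h ` Y = {m}" by (auto simp: card_1_singleton_iff)
  then have "h ` Y = UNIV - {m}" by blast
  then show thesis using that assms(1) by (auto simp: bij_betw_def)
qed

lemma pseudorectangle_of_label:
  fixes h :: "'a \<Rightarrow> bool \<times> bool"
  assumes "h ` X = UNIV"
  shows "pseudorectangle X (\<lambda>x y. rectangle_dist (h x) (h y))" (is "pseudorectangle X ?d")
proof -
  have pm: "pseudometric_on X ?d"
    unfolding pseudometric_on_def by (auto simp: rectangle_dist_def)
  have inj: "inj_on h Y" if "metric_subspace Y X ?d" for Y
    using that unfolding metric_subspace_iff rectangle_dist_eq_0_iff by (auto intro: inj_onI)
  have "strongly_rigid_metric Y ?d" if Y: "metric_subspace Y X ?d" "card Y = 3" for Y
  proof -
    obtain m where m: "bij_betw h Y (UNIV - {m})"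
      using bij_betw_complement_point[OF inj[OF Y(1)] Y(2)] .
    then have ne: "\<And>x. x \<in> Y \<Longrightarrow> h x \<noteq> m" by (auto dest: bij_betwE)
    show ?thesis
      unfolding strongly_rigid_metric_def
      using strongly_rigid_rectangle_dist_triangle[OF ne ne ne ne] inj_onD[OF inj[OF Y(1)]]
      by blast
  qed
  moreover have "isometric_spaces Y ?d Z ?d"
    if Y: "metric_subspace Y X ?d" "card Y = 3" and Z: "metric_subspace Z X ?d" "card Z = 3"
    for Y Z
  proof -
    obtain m where m: "bij_betw h Y (UNIV - {m})"
      using bij_betw_complement_point[OF inj[OF Y(1)] Y(2)] .
    obtain n where n: "bij_betw h Z (UNIV - {n})"
      using bij_betw_complement_point[OF inj[OF Z(1)] Z(2)] .
    \<comment> \<open>The group difference of \<open>m\<close> and \<open>n\<close>, which is their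
      sum here: translation by it carries the missing vertex of \<open>Y\<close> to that of
      \<open>Z\<close>.\<close>
    define c where "c = klein_add m n"
    have "klein_add c m = n"
      unfolding c_def by (metis klein_add_cancel klein_add_commute)
    moreover have "bij (klein_add c)" by (rule involuntory_imp_bij) simp
    ultimately have t: "bij_betw (klein_add c) (UNIV - {m}) (UNIV - {n})"
      by (auto simp: bij_betw_def image_set_diff intro: inj_on_subset)
    \<comment> \<open>Each point of \<open>Y\<close> goes to the point of \<open>Z\<close> carrying
      the translated label.\<close>
    define f where "f = inv_into Z h \<circ> (klein_add c \<circ> h)"
    have "bij_betw f Y Z"
      unfolding f_def by (intro bij_betw_trans[OF bij_betw_trans[OF m t]] bij_betw_inv_into n)
    moreover have "h (f x) = klein_add c (h x)" if "x \<in> Y" for x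
    proof -
      have "klein_add c (h x) \<in> h ` Z"
        using bij_betw_apply[OF bij_betw_trans[OF m t] that] n by (simp add: bij_betw_def)
      then show ?thesis unfolding f_def by (simp add: f_inv_into_f)
    qed
    ultimately show ?thesis
      unfolding isometric_spaces_def by (auto intro!: exI[of _ f] simp: rectangle_dist_translate)
  qed
  moreover have "\<exists>Y. metric_subspace Y X ?d \<and> card Y = 4 \<and> (\<forall>x\<in>X. \<exists>y\<in>Y. ?d x y = 0)"
  proof -
    obtain Y where Y: "Y \<subseteq> X" "inj_on h Y" "h ` Y = UNIV"
      using subset_image_inj[of UNIV h X] assms by auto
    have "metric_subspace Y X ?d"
      using Y by (intro metric_subspace_of_pseudometric_on[OF pm])
        (auto simp: rectangle_dist_eq_0_iff dest: inj_onD)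
    moreover have "card Y = 4" using card_image[OF Y(2)] Y(3) by simp
    moreover have "\<forall>x\<in>X. \<exists>y\<in>Y. ?d x y = 0"
      unfolding rectangle_dist_eq_0_iff using Y(3) by (metis UNIV_I imageE)
    ultimately show ?thesis by blast
  qed
  ultimately show ?thesis
    unfolding pseudorectangle_def using pm by blast
qed

theorem proposition5p10:
  fixes X :: "'a set" and r :: "('a \<times> 'a) set"
    and J :: "'j set" and B :: "'j \<Rightarrow> 'a set"
  assumes "X \<noteq> {}"
    and "equiv X r"
    and "B ` J = X // r"
    and "inj_on B J"
  shows "(J \<lesssim> (UNIV :: real set) \<longleftrightarrow>
            (\<exists>d. strongly_rigid_pseudometric X d \<and>
                 (\<forall>x\<in>X. \<forall>y\<in>X. (x, y) \<in> r \<longleftrightarrow> d x y = 0)))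
       \<and> (card J = 4 \<longleftrightarrow>
            (\<exists>d. pseudorectangle X d \<and>
                 (\<forall>x\<in>X. \<forall>y\<in>X. (x, y) \<in> r \<longleftrightarrow> d x y = 0)))"
proof -
  have B: "bij_betw B J (X // r)" using assms(3,4) by (simp add: bij_betw_def)
  then have "J \<approx> X // r" by (auto simp: eqpoll_def)
  then have lepoll: "J \<lesssim> (UNIV :: real set) \<longleftrightarrow> X // r \<lesssim> (UNIV :: real set)"
    by (meson eqpoll_imp_lepoll eqpoll_sym lepoll_trans)
  have card: "card J = card (X // r)" using B by (rule bij_betw_same_card)
  show ?thesis unfolding lepoll card
  proof (intro conjI iffI)
    assume "X // r \<lesssim> (UNIV :: real set)"
    then obtain h :: "'a set \<Rightarrow> real" where h: "inj_on h (X // r)"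
      by (auto simp: lepoll_def)
    obtain d where "strongly_rigid_pseudometric X d"
      "\<And>x y. d x y = 0 \<longleftrightarrow> h (r `` {x}) = h (r `` {y})"
      using strongly_rigid_pseudometric_of_real_label[where h = "\<lambda>x. h (r `` {x})"] by blast
    then show "\<exists>d. strongly_rigid_pseudometric X d \<and> (\<forall>x\<in>X. \<forall>y\<in>X. (x, y) \<in> r \<longleftrightarrow> d x y = 0)"
      using equiv_quotient_label[OF assms(2) h] by metis
  next
    assume "\<exists>d. strongly_rigid_pseudometric X d \<and> (\<forall>x\<in>X. \<forall>y\<in>X. (x, y) \<in> r \<longleftrightarrow> d x y = 0)"
    then obtain d where d: "strongly_rigid_pseudometric X d"
      "\<And>x y. x \<in> X \<Longrightarrow> y \<in> X \<Longrightarrow> (x, y) \<in> r \<longleftrightarrow> d x y = 0"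
      by blast
    obtain Y where Y: "Y \<subseteq> X" "bij_betw (\<lambda>x. r `` {x}) Y (X // r)"
      using quotient_representatives .
    \<comment> \<open>Representatives at distance zero lie in one block and so coincide; strong
      rigidity of \<open>d\<close> then applies to \<open>Y\<close>.\<close>
    have "metric_subspace Y X d"
    proof (rule metric_subspace_of_pseudometric_on)
      show "pseudometric_on X d" using d(1) by (simp add: strongly_rigid_pseudometric_def)
      fix x y assume xy: "x \<in> Y" "y \<in> Y" "d x y = 0"
      then have "r `` {x} = r `` {y}"
        using d(2) Y(1) equiv_class_eq[OF assms(2)] by blast
      then show "x = y" using Y(2) xy by (auto simp: bij_betw_def dest: inj_onD)
    qed (fact Y(1))
    then have "Y \<lesssim> (UNIV :: real set)"
      using d(1) strongly_rigid_metric_lepoll_real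
      unfolding strongly_rigid_pseudometric_def by blast
    moreover have "X // r \<approx> Y" using Y(2) by (meson eqpoll_def eqpoll_sym)
    ultimately show "X // r \<lesssim> (UNIV :: real set)" by (meson eqpoll_imp_lepoll lepoll_trans)
  next
    assume c4: "card (X // r) = 4"
    \<comment> \<open>\<open>card\<close> is 0 on infinite sets, so the value 4 forces
      finiteness.\<close>
    then have "finite (X // r)" using card.infinite by fastforce
    moreover have "card (X // r) = card (UNIV :: (bool \<times> bool) set)" using c4 by simp
    ultimately obtain h :: "'a set \<Rightarrow> bool \<times> bool" where h: "bij_betw h (X // r) UNIV"
      using finite_same_card_bij finite_class.finite_UNIV by blast
    have "(\<lambda>x. h (r `` {x})) ` X = h ` (X // r)" by (auto simp: quotient_def)
    then have "(\<lambda>x. h (r `` {x})) ` X = UNIV" using h by (simp add: bij_betw_def)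
    then have "pseudorectangle X (\<lambda>x y. rectangle_dist (h (r `` {x})) (h (r `` {y})))"
      by (rule pseudorectangle_of_label)
    moreover have "\<forall>x\<in>X. \<forall>y\<in>X. (x, y) \<in> r \<longleftrightarrow>
        rectangle_dist (h (r `` {x})) (h (r `` {y})) = 0"
      unfolding rectangle_dist_eq_0_iff
      using equiv_quotient_label[OF assms(2) bij_betw_imp_inj_on[OF h]] by blast
    ultimately show "\<exists>d. pseudorectangle X d \<and> (\<forall>x\<in>X. \<forall>y\<in>X. (x, y) \<in> r \<longleftrightarrow> d x y = 0)"
      by (intro exI conjI)
  next
    assume "\<exists>d. pseudorectangle X d \<and> (\<forall>x\<in>X. \<forall>y\<in>X. (x, y) \<in> r \<longleftrightarrow> d x y = 0)"
    then obtain d Y where "\<And>x y. x \<in> X \<Longrightarrow> y \<in> X \<Longrightarrow> (x, y) \<in> r \<longleftrightarrow> d x y = 0"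
      "metric_subspace Y X d" "card Y = 4" "\<And>x. x \<in> X \<Longrightarrow> \<exists>y\<in>Y. d x y = 0"
      unfolding pseudorectangle_def by metis
    then show "card (X // r) = 4"
      using bij_betw_same_card[OF bij_betw_quotient_of_metric_subspace[OF assms(2)]] by metis
  qed
qed

end
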